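(* Let $\Omega$ be a commutative semigroup. Let $(A,\cdot,\{\,,\})$ be a Poisson algebra and let $(P_\omega:A\to A)_{\omega\in\Omega}$ be a Rota-Baxter family of weight $0$ on it. Define new operations on $A$ by $$x\ast_\omega y=P_\omega(x)\cdot y\quad\text{and}\quad x\rhd_\omega y=\{P_\omega(x), y\},\qquad \omega\in\Omega.$$ Then $(A,(\ast_\omega,\rhd_\omega)_{\omega\in\Omega})$ is a left pre-Poisson family algebra.
   Context: $\mathbf{k}$ is a unitary commutative ring, the base ring for all modules, algebras and linear maps. Algebras are unitary and associative. Poisson algebra: a triple $(A,\cdot,\{\,,\})$ where $(A,\cdot)$ is a commutative algebra, $(A,\{\,,\})$ is a Lie algebra, and $\{x,y\cdot z\}=\{x,y\}\cdot z+y\cdot\{x,z\}$. A Rota-Baxter family of weight $0$ on it is a family of linear maps $P_\omega:A\to A$, $\omega\in\Omega$, satisfying the weight-$0$ Rota-Baxter family identity for both products: $P_{\alpha}(x)\cdot P_{\beta}(y)=P_{\alpha\beta}\bigl(P_{\alpha}(x)\cdot y+x\cdot P_{\beta}(y)\bigr)$ and $\{P_{\alpha}(x),P_{\beta}(y)\}=P_{\alpha\beta}\bigl(\{P_{\alpha}(x),y\}+\{x,P_{\beta}(y)\}\bigr)$ for all $x,y\in A$, $\alpha,\beta\in\Omega$. Left pre-Poisson family algebra: a $\mathbf{k}$-module $A$ with bilinear operations $\ast_\omega,\rhd_\omega$, $\omega\in\Omega$, such that for all $x,y,z\in A$, $\alpha,\beta\in\Omega$: (left Zinbiel family) $x\ast_\alpha(y\ast_\beta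 z)=(x\ast_\alpha y)\ast_{\alpha\beta} z+(y\ast_\beta x)\ast_{\alpha\beta} z$; (left pre-Lie family) $x\rhd_\alpha(y\rhd_\beta z)-(x\rhd_\alpha y)\rhd_{\alpha\beta}z=y\rhd_\beta(x\rhd_\alpha z)-(y\rhd_\beta x)\rhd_{\beta\alpha}z$; $(x\rhd_\alpha y-y\rhd_\beta x)\ast_{\alpha\beta}z=x\rhd_\alpha(y\ast_\beta z)-y\ast_\beta(x\rhd_\alpha z)$; $(x\ast_\alpha y+y\ast_\beta x)\rhd_{\alpha\beta}z=x\ast_\alpha(y\rhd_\beta z)+y\ast_\beta(x\rhd_\alpha z)$. *)

theory Defs
  imports "HOL-Algebra.Module"
begin

text \<open>
  The base ring and the modules and algebras over it are HOL-Algebra structures, so the zero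
  ring and the zero module are allowed. HOL-Algebra's \<^locale>\<open>algebra\<close> is a commutative,
  associative, unitary algebra over a commutative unitary ring. Only the additive group and the
  scalar multiplication of \<open>M\<close> matter for \<^term>\<open>module R M\<close>.
\<close>

definition linear_endo :: "('k, 'r) ring_scheme \<Rightarrow> ('k, 'a, 'm) module_scheme \<Rightarrow> ('a \<Rightarrow> 'a) \<Rightarrow> bool"
  where "linear_endo R M f \<longleftrightarrow>
    f \<in> carrier M \<rightarrow> carrier M \<and>
    (\<forall>x\<in>carrier M. \<forall>y\<in>carrier M. f (x \<oplus>\<^bsub>M\<^esub> y) = f x \<oplus>\<^bsub>M\<^esub> f y) \<and>
    (\<forall>c\<in>carrier R. \<forall>x\<in>carrier M. f (c \<odot>\<^bsub>M\<^esub> x) = c \<odot>\<^bsub>M\<^esub> f x)"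

definition bilinear_op ::
    "('k, 'r) ring_scheme \<Rightarrow> ('k, 'a, 'm) module_scheme \<Rightarrow> ('a \<Rightarrow> 'a \<Rightarrow> 'a) \<Rightarrow> bool"
  where "bilinear_op R M m \<longleftrightarrow>
    (\<forall>x\<in>carrier M. linear_endo R M (\<lambda>y. m x y)) \<and>
    (\<forall>y\<in>carrier M. linear_endo R M (\<lambda>x. m x y))"

text \<open>
  Over an arbitrary base ring (where 2 may fail to be invertible) a Lie bracket is required to be
  alternating, which implies antisymmetry.
\<close>

locale lie_algebra = module R M for R (structure) and M (structure) +
  fixes bracket :: "'c \<Rightarrow> 'c \<Rightarrow> 'c"
  assumes bracket_bilinear: "bilinear_op R M bracket"
    and bracket_alternating: "x \<in> carrier M \<Longrightarrow> bracket x x = \<zero>\<^bsub>M\<^esub>"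
    and bracket_jacobi:
      "\<lbrakk>x \<in> carrier M; y \<in> carrier M; z \<in> carrier M\<rbrakk> \<Longrightarrow>
        bracket x (bracket y z) \<oplus>\<^bsub>M\<^esub> bracket y (bracket z x) \<oplus>\<^bsub>M\<^esub> bracket z (bracket x y)
          = \<zero>\<^bsub>M\<^esub>"

locale poisson_algebra = algebra R M + lie_algebra R M bracket
  for R (structure) and M (structure) and bracket +
  assumes leibniz:
      "\<lbrakk>x \<in> carrier M; y \<in> carrier M; z \<in> carrier M\<rbrakk> \<Longrightarrow>
        bracket x (y \<otimes>\<^bsub>M\<^esub> z) = bracket x y \<otimes>\<^bsub>M\<^esub> z \<oplus>\<^bsub>M\<^esub> y \<otimes>\<^bsub>M\<^esub> bracket x z"

text \<open>
  The weight-0 Rota-Baxter family identity with respect to a binary operation \<open>m\<close>; the index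
  semigroup is the whole type \<^typ>\<open>'w\<close>.
\<close>

definition rota_baxter_family_identity ::
    "('k, 'a, 'm) module_scheme \<Rightarrow> ('a \<Rightarrow> 'a \<Rightarrow> 'a) \<Rightarrow> ('w::semigroup_mult \<Rightarrow> 'a \<Rightarrow> 'a) \<Rightarrow> bool"
  where "rota_baxter_family_identity M m P \<longleftrightarrow>
    (\<forall>\<alpha> \<beta>. \<forall>x\<in>carrier M. \<forall>y\<in>carrier M.
      m (P \<alpha> x) (P \<beta> y) = P (\<alpha> * \<beta>) (m (P \<alpha> x) y \<oplus>\<^bsub>M\<^esub> m x (P \<beta> y)))"

definition poisson_rota_baxter_family ::
    "('k, 'r) ring_scheme \<Rightarrow> ('k, 'a, 'm) module_scheme \<Rightarrow> ('a \<Rightarrow> 'a \<Rightarrow> 'a) \<Rightarrow>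
      ('w::semigroup_mult \<Rightarrow> 'a \<Rightarrow> 'a) \<Rightarrow> bool"
  where "poisson_rota_baxter_family R M bracket P \<longleftrightarrow>
    (\<forall>\<omega>. linear_endo R M (P \<omega>)) \<and>
    rota_baxter_family_identity M (\<lambda>x y. x \<otimes>\<^bsub>M\<^esub> y) P \<and>
    rota_baxter_family_identity M bracket P"

locale left_pre_poisson_family_algebra = module R M for R (structure) and M (structure) +
  fixes star :: "'w::ab_semigroup_mult \<Rightarrow> 'c \<Rightarrow> 'c \<Rightarrow> 'c"
    and rhd :: "'w \<Rightarrow> 'c \<Rightarrow> 'c \<Rightarrow> 'c"
  assumes star_bilinear: "bilinear_op R M (star \<omega>)"
    and rhd_bilinear: "bilinear_op R M (rhd \<omega>)"
    and left_zinbiel_family: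
      "\<lbrakk>x \<in> carrier M; y \<in> carrier M; z \<in> carrier M\<rbrakk> \<Longrightarrow>
        star \<alpha> x (star \<beta> y z) =
          star (\<alpha> * \<beta>) (star \<alpha> x y) z \<oplus>\<^bsub>M\<^esub> star (\<alpha> * \<beta>) (star \<beta> y x) z"
    and left_pre_lie_family:
      "\<lbrakk>x \<in> carrier M; y \<in> carrier M; z \<in> carrier M\<rbrakk> \<Longrightarrow>
        rhd \<alpha> x (rhd \<beta> y z) \<ominus>\<^bsub>M\<^esub> rhd (\<alpha> * \<beta>) (rhd \<alpha> x y) z =
          rhd \<beta> y (rhd \<alpha> x z) \<ominus>\<^bsub>M\<^esub> rhd (\<beta> * \<alpha>) (rhd \<beta> y x) z"
    and star_of_rhd_commutator:
      "\<lbrakk>x \<in> carrier M; y \<in> carrier M; z \<in> carrier M\<rbrakk> \<Longrightarrow>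
        star (\<alpha> * \<beta>) (rhd \<alpha> x y \<ominus>\<^bsub>M\<^esub> rhd \<beta> y x) z =
          rhd \<alpha> x (star \<beta> y z) \<ominus>\<^bsub>M\<^esub> star \<beta> y (rhd \<alpha> x z)"
    and rhd_of_star_anticommutator:
      "\<lbrakk>x \<in> carrier M; y \<in> carrier M; z \<in> carrier M\<rbrakk> \<Longrightarrow>
        rhd (\<alpha> * \<beta>) (star \<alpha> x y \<oplus>\<^bsub>M\<^esub> star \<beta> y x) z =
          star \<alpha> x (rhd \<beta> y z) \<oplus>\<^bsub>M\<^esub> star \<beta> y (rhd \<alpha> x z)"

end

theory Submission
  imports Defs
begin

text \<open>
  The Rota-Baxter identity for the bracket turns \<open>P\<^sub>\<alpha>\<^sub>\<beta> (x \<rhd>\<^sub>\<alpha> y - y \<rhd>\<^sub>\<beta> x)\<close> into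
  \<open>{P\<^sub>\<alpha> x, P\<^sub>\<beta> y}\<close>, and the one for the product turns \<open>P\<^sub>\<alpha>\<^sub>\<beta> (x *\<^sub>\<alpha> y + y *\<^sub>\<beta> x)\<close> into
  \<open>P\<^sub>\<alpha> x \<cdot> P\<^sub>\<beta> y\<close>. After this substitution the four axioms become associativity, the Jacobi identity
  and the two Leibniz rules, evaluated at \<open>P\<^sub>\<alpha> x\<close>, \<open>P\<^sub>\<beta> y\<close> and \<open>z\<close>.
\<close>

lemma bilinear_opI:
  assumes "\<And>x y. \<lbrakk>x \<in> carrier M; y \<in> carrier M\<rbrakk> \<Longrightarrow> m x y \<in> carrier M"
    and "\<And>x y z. \<lbrakk>x \<in> carrier M; y \<in> carrier M; z \<in> carrier M\<rbrakk> \<Longrightarrow>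
      m x (y \<oplus>\<^bsub>M\<^esub> z) = m x y \<oplus>\<^bsub>M\<^esub> m x z"
    and "\<And>x y z. \<lbrakk>x \<in> carrier M; y \<in> carrier M; z \<in> carrier M\<rbrakk> \<Longrightarrow>
      m (x \<oplus>\<^bsub>M\<^esub> y) z = m x z \<oplus>\<^bsub>M\<^esub> m y z"
    and "\<And>c x y. \<lbrakk>c \<in> carrier R; x \<in> carrier M; y \<in> carrier M\<rbrakk> \<Longrightarrow>
      m x (c \<odot>\<^bsub>M\<^esub> y) = c \<odot>\<^bsub>M\<^esub> m x y"
    and "\<And>c x y. \<lbrakk>c \<in> carrier R; x \<in> carrier M; y \<in> carrier M\<rbrakk> \<Longrightarrow>
      m (c \<odot>\<^bsub>M\<^esub> x) y = c \<odot>\<^bsub>M\<^esub> m x y"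
  shows "bilinear_op R M m"
  using assms unfolding bilinear_op_def linear_endo_def by auto

lemma linear_endo_closed: "linear_endo R M f \<Longrightarrow> x \<in> carrier M \<Longrightarrow> f x \<in> carrier M"
  unfolding linear_endo_def by auto

lemma linear_endo_add:
  "\<lbrakk>linear_endo R M f; x \<in> carrier M; y \<in> carrier M\<rbrakk> \<Longrightarrow> f (x \<oplus>\<^bsub>M\<^esub> y) = f x \<oplus>\<^bsub>M\<^esub> f y"
  unfolding linear_endo_def by auto

text \<open>Additivity makes \<open>f\<close> an endomorphism of the underlying abelian group, and
  group homomorphisms preserve inverses.\<close>

lemma (in module) linear_endo_minus:
  assumes f: "linear_endo R M f" and x: "x \<in> carrier M"
  shows "f (\<ominus>\<^bsub>M\<^esub> x) = \<ominus>\<^bsub>M\<^esub> f x"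
proof -
  have "group_hom (add_monoid M) (add_monoid M) f"
    using f by unfold_locales (auto simp: hom_def linear_endo_def)
  then show ?thesis
    using group_hom.hom_inv[of "add_monoid M" "add_monoid M" f x] x by (simp add: a_inv_def)
qed

text \<open>Both new operations arise in this way, with \<open>f\<close> a Rota-Baxter operator and
  \<open>m\<close> the product or the bracket.\<close>

lemma bilinear_op_comp_left:
  assumes "bilinear_op R M m" and "linear_endo R M f"
  shows "bilinear_op R M (\<lambda>x y. m (f x) y)"
  using assms unfolding bilinear_op_def linear_endo_def by (auto simp: Pi_iff)

lemma (in algebra) mult_bilinear: "bilinear_op R M (\<lambda>x y. x \<otimes>\<^bsub>M\<^esub> y)"
proof (rule bilinear_opI)
  fix c x y assume c: "c \<in> carrier R" and x: "x \<in> carrier M" and y: "y \<in> carrier M"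
  show "(c \<odot>\<^bsub>M\<^esub> x) \<otimes>\<^bsub>M\<^esub> y = c \<odot>\<^bsub>M\<^esub> (x \<otimes>\<^bsub>M\<^esub> y)"
    using c x y by (rule smult_assoc2)
  \<comment> \<open>Homogeneity in the right factor comes from that in the left factor by
    commutativity.\<close>
  show "x \<otimes>\<^bsub>M\<^esub> (c \<odot>\<^bsub>M\<^esub> y) = c \<odot>\<^bsub>M\<^esub> (x \<otimes>\<^bsub>M\<^esub> y)"
    using c x y smult_assoc2[of c y x] by (simp add: m_comm)
qed (simp_all add: l_distr r_distr)

text \<open>Exchanges the two middle terms: the Jacobi identity yields an equation between
  commutators, whereas the pre-Lie axiom compares associators.\<close>

lemma (in abelian_group) minus_eq_minus_swap:
  assumes "a \<in> carrier G" "b \<in> carrier G" "c \<in> carrier G" "d \<in> carrier G"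
    and "a \<ominus> c = b \<ominus> d"
  shows "a \<ominus> b = c \<ominus> d"
proof -
  have "a = b \<ominus> d \<oplus> c"
    using assms by (metis minus_closed add.inv_solve_right minus_eq)
  \<comment> \<open>\<open>r_neg\<close> is withheld so that the pair \<open>b\<close>,
    \<open>\<ominus> b\<close> survives and both sides are the same four-term sum up to
    order.\<close>
  then have "a \<ominus> b = (b \<oplus> \<ominus> b) \<oplus> (c \<ominus> d)"
    using assms(1-4) by (simp add: minus_eq a_ac del: r_neg)
  then show ?thesis
    using assms(1-4) by (simp add: r_neg)
qed

context lie_algebra
begin

lemma bracket_linear_right: "x \<in> carrier M \<Longrightarrow> linear_endo R M (bracket x)"
  using bracket_bilinear unfolding bilinear_op_def by auto

lemma bracket_linear_left: "y \<in> carrier M \<Longrightarrow> linear_endo R M (\<lambda>x. bracket x y)"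
  using bracket_bilinear unfolding bilinear_op_def by auto

lemma bracket_closed [simp]:
  "\<lbrakk>x \<in> carrier M; y \<in> carrier M\<rbrakk> \<Longrightarrow> bracket x y \<in> carrier M"
  by (rule linear_endo_closed[OF bracket_linear_right])

text \<open>Polarization: expand the vanishing bracket of \<open>x \<oplus> y\<close> with itself.
  The two diagonal terms vanish too, so the mixed terms sum to zero.\<close>

lemma bracket_antisym:
  assumes x: "x \<in> carrier M" and y: "y \<in> carrier M"
  shows "bracket x y = \<ominus>\<^bsub>M\<^esub> bracket y x"
proof -
  have "\<zero>\<^bsub>M\<^esub> = bracket (x \<oplus>\<^bsub>M\<^esub> y) (x \<oplus>\<^bsub>M\<^esub> y)"
    using x y by (simp add: bracket_alternating)
  also have "\<dots> = bracket x x \<oplus>\<^bsub>M\<^esub> bracket x y \<oplus>\<^bsub>M\<^esub> (bracket y x \<oplus>\<^bsub>M\<^esub> bracket y y)"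
    using x y by (simp add: linear_endo_add[OF bracket_linear_left]
        linear_endo_add[OF bracket_linear_right] M.a_ac)
  also have "\<dots> = bracket x y \<oplus>\<^bsub>M\<^esub> bracket y x"
    using x y by (simp add: bracket_alternating)
  finally show ?thesis
    using x y by (simp add: M.minus_equality)
qed

text \<open>The Jacobi identity read as a statement about adjoint maps: bracketing with
  \<open>bracket x y\<close> is the commutator of bracketing with \<open>x\<close> and with
  \<open>y\<close>. Antisymmetry brings the cyclic form into this shape.\<close>

lemma bracket_bracket_left:
  assumes x: "x \<in> carrier M" and y: "y \<in> carrier M" and z: "z \<in> carrier M"
  shows "bracket (bracket x y) z = bracket x (bracket y z) \<ominus>\<^bsub>M\<^esub> bracket y (bracket x z)"
proof -
  have "bracket y (bracket z x) = \<ominus>\<^bsub>M\<^esub> bracket y (bracket x z)"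
    using x y z bracket_antisym[of z x]
    by (simp add: linear_endo_minus[OF bracket_linear_right])
  moreover have "bracket z (bracket x y) = \<ominus>\<^bsub>M\<^esub> bracket (bracket x y) z"
    using x y z by (intro bracket_antisym) auto
  ultimately have "bracket x (bracket y z) \<ominus>\<^bsub>M\<^esub> bracket y (bracket x z)
      \<oplus>\<^bsub>M\<^esub> \<ominus>\<^bsub>M\<^esub> bracket (bracket x y) z = \<zero>\<^bsub>M\<^esub>"
    using bracket_jacobi[OF x y z] by (simp add: M.minus_eq)
  then show ?thesis
    using x y z M.minus_equality[of "bracket x (bracket y z) \<ominus>\<^bsub>M\<^esub> bracket y (bracket x z)"
        "\<ominus>\<^bsub>M\<^esub> bracket (bracket x y) z"]
    by simp
qed

text \<open>Antisymmetry rewrites \<open>bracket x (P \<beta> y)\<close> as minus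
  \<open>bracket (P \<beta> y) x\<close>, so the argument of the outer operator in the Rota-Baxter
  identity becomes the commutator of the new operations.\<close>

lemma rota_baxter_bracket:
  assumes rb: "rota_baxter_family_identity M bracket P"
    and P: "\<And>\<omega>. linear_endo R M (P \<omega>)"
    and x: "x \<in> carrier M" and y: "y \<in> carrier M"
  shows "P (\<alpha> * \<beta>) (bracket (P \<alpha> x) y \<ominus>\<^bsub>M\<^esub> bracket (P \<beta> y) x) = bracket (P \<alpha> x) (P \<beta> y)"
  using rb x y bracket_antisym[OF x linear_endo_closed[OF P y]]
  unfolding rota_baxter_family_identity_def by (simp add: M.minus_eq)

end

context poisson_algebra
begin

text \<open>The Leibniz rule solved for its first summand, the orientation that the third axiom asks
  for.\<close>

lemma bracket_mult_right:
  assumes "x \<in> carrier M" "y \<in> carrier M" "z \<in> carrier M"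
  shows "bracket x y \<otimes>\<^bsub>M\<^esub> z = bracket x (y \<otimes>\<^bsub>M\<^esub> z) \<ominus>\<^bsub>M\<^esub> y \<otimes>\<^bsub>M\<^esub> bracket x z"
  using assms by (simp add: leibniz M.minus_eq M.a_assoc M.r_neg)

text \<open>Two uses of antisymmetry carry the derivation property from the second argument of the
  bracket to the first.\<close>

lemma leibniz_left:
  assumes x: "x \<in> carrier M" and y: "y \<in> carrier M" and z: "z \<in> carrier M"
  shows "bracket (x \<otimes>\<^bsub>M\<^esub> y) z = x \<otimes>\<^bsub>M\<^esub> bracket y z \<oplus>\<^bsub>M\<^esub> y \<otimes>\<^bsub>M\<^esub> bracket x z"
proof -
  have "bracket (x \<otimes>\<^bsub>M\<^esub> y) z = \<ominus>\<^bsub>M\<^esub> bracket z (x \<otimes>\<^bsub>M\<^esub> y)"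
    using x y z by (intro bracket_antisym) auto
  also have "\<dots> = \<ominus>\<^bsub>M\<^esub> (bracket z x \<otimes>\<^bsub>M\<^esub> y \<oplus>\<^bsub>M\<^esub> x \<otimes>\<^bsub>M\<^esub> bracket z y)"
    using x y z by (simp add: leibniz)
  also have "\<dots> = y \<otimes>\<^bsub>M\<^esub> (\<ominus>\<^bsub>M\<^esub> bracket z x) \<oplus>\<^bsub>M\<^esub> x \<otimes>\<^bsub>M\<^esub> (\<ominus>\<^bsub>M\<^esub> bracket z y)"
    using x y z by (simp add: M.minus_add r_minus m_comm)
  also have "\<dots> = x \<otimes>\<^bsub>M\<^esub> bracket y z \<oplus>\<^bsub>M\<^esub> y \<otimes>\<^bsub>M\<^esub> bracket x z"
    using x y z by (simp add: bracket_antisym[of x z] bracket_antisym[of y z] M.a_comm)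
  finally show ?thesis .
qed

text \<open>Commutativity replaces \<open>x \<otimes> P \<beta> y\<close> by
  \<open>P \<beta> y \<otimes> x\<close>, which gives the anticommutator of the new
  operations.\<close>

lemma rota_baxter_mult:
  assumes rb: "rota_baxter_family_identity M (\<lambda>x y. x \<otimes>\<^bsub>M\<^esub> y) P"
    and P: "\<And>\<omega>. linear_endo R M (P \<omega>)"
    and x: "x \<in> carrier M" and y: "y \<in> carrier M"
  shows "P (\<alpha> * \<beta>) (P \<alpha> x \<otimes>\<^bsub>M\<^esub> y \<oplus>\<^bsub>M\<^esub> P \<beta> y \<otimes>\<^bsub>M\<^esub> x) = P \<alpha> x \<otimes>\<^bsub>M\<^esub> P \<beta> y"
  using rb x y m_comm[OF x linear_endo_closed[OF P y]]
  unfolding rota_baxter_family_identity_def by simp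

end

theorem proposition5p6:
  fixes R :: "('k, 'r) ring_scheme"
    and A :: "('k, 'a, 'm) module_scheme"
    and bracket :: "'a \<Rightarrow> 'a \<Rightarrow> 'a"
    and P :: "'w::ab_semigroup_mult \<Rightarrow> 'a \<Rightarrow> 'a"
  assumes "poisson_algebra R A bracket"
    and "poisson_rota_baxter_family R A bracket P"
  shows "left_pre_poisson_family_algebra R A
    (\<lambda>\<omega> x y. P \<omega> x \<otimes>\<^bsub>A\<^esub> y)
    (\<lambda>\<omega> x y. bracket (P \<omega> x) y)"
proof -
  interpret A: poisson_algebra R A bracket by fact
  have P: "linear_endo R A (P \<omega>)" for \<omega>
    using assms(2) unfolding poisson_rota_baxter_family_def by auto
  have mult: "rota_baxter_family_identity A (\<lambda>x y. x \<otimes>\<^bsub>A\<^esub> y) P"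
    and brack: "rota_baxter_family_identity A bracket P"
    using assms(2) unfolding poisson_rota_baxter_family_def by auto
  note PC [simp] = linear_endo_closed[OF P]
  note rb_mult = A.rota_baxter_mult[OF mult P]
  note rb_bracket = A.rota_baxter_bracket[OF brack P]
  show ?thesis
  proof unfold_locales
    show "bilinear_op R A (\<lambda>x y. P \<omega> x \<otimes>\<^bsub>A\<^esub> y)" for \<omega>
      by (rule bilinear_op_comp_left[OF A.mult_bilinear P])
    show "bilinear_op R A (\<lambda>x y. bracket (P \<omega> x) y)" for \<omega>
      by (rule bilinear_op_comp_left[OF A.bracket_bilinear P])
  next
    fix x y z \<alpha> \<beta>
    assume x: "x \<in> carrier A" and y: "y \<in> carrier A" and z: "z \<in> carrier A"
    \<comment> \<open>Zinbiel axiom: the two right-hand terms merge under one operator, which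
      \<open>rb_mult\<close> then evaluates; associativity remains.\<close>
    have "P (\<alpha> * \<beta>) (P \<alpha> x \<otimes>\<^bsub>A\<^esub> y) \<otimes>\<^bsub>A\<^esub> z \<oplus>\<^bsub>A\<^esub> P (\<alpha> * \<beta>) (P \<beta> y \<otimes>\<^bsub>A\<^esub> x) \<otimes>\<^bsub>A\<^esub> z
        = P (\<alpha> * \<beta>) (P \<alpha> x \<otimes>\<^bsub>A\<^esub> y \<oplus>\<^bsub>A\<^esub> P \<beta> y \<otimes>\<^bsub>A\<^esub> x) \<otimes>\<^bsub>A\<^esub> z"
      using x y z by (simp add: linear_endo_add[OF P] A.l_distr)
    then show "P \<alpha> x \<otimes>\<^bsub>A\<^esub> (P \<beta> y \<otimes>\<^bsub>A\<^esub> z) =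
        P (\<alpha> * \<beta>) (P \<alpha> x \<otimes>\<^bsub>A\<^esub> y) \<otimes>\<^bsub>A\<^esub> z \<oplus>\<^bsub>A\<^esub> P (\<alpha> * \<beta>) (P \<beta> y \<otimes>\<^bsub>A\<^esub> x) \<otimes>\<^bsub>A\<^esub> z"
      using x y z by (simp add: rb_mult A.m_assoc)
    let ?u = "P \<alpha> x" and ?v = "P \<beta> y"
    \<comment> \<open>Pre-Lie axiom: the Jacobi identity at \<open>?u\<close>, \<open>?v\<close>,
      \<open>z\<close>, with the inner bracket of \<open>?u\<close> and \<open>?v\<close> written as
      an image of the operator at \<open>\<alpha> * \<beta>\<close>, to be split by
      linearity.\<close>
    have "bracket ?u (bracket ?v z) \<ominus>\<^bsub>A\<^esub> bracket ?v (bracket ?u z)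
        = bracket (P (\<alpha> * \<beta>) (bracket ?u y \<ominus>\<^bsub>A\<^esub> bracket ?v x)) z"
      using x y z by (simp add: rb_bracket A.bracket_bracket_left)
    also have "\<dots> = bracket (P (\<alpha> * \<beta>) (bracket ?u y)) z
        \<ominus>\<^bsub>A\<^esub> bracket (P (\<alpha> * \<beta>) (bracket ?v x)) z"
      using x y z by (simp add: A.M.minus_eq linear_endo_add[OF P] A.linear_endo_minus[OF P]
          linear_endo_add[OF A.bracket_linear_left]
          A.linear_endo_minus[OF A.bracket_linear_left])
    finally have *: "bracket ?u (bracket ?v z) \<ominus>\<^bsub>A\<^esub> bracket ?v (bracket ?u z) =
        bracket (P (\<alpha> * \<beta>) (bracket ?u y)) z
          \<ominus>\<^bsub>A\<^esub> bracket (P (\<alpha> * \<beta>) (bracket ?v x)) z" .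
    \<comment> \<open>The last term carries the index \<open>\<beta> * \<alpha>\<close>;
      commutativity of the index semigroup identifies it with
      \<open>\<alpha> * \<beta>\<close>.\<close>
    show "bracket ?u (bracket ?v z) \<ominus>\<^bsub>A\<^esub> bracket (P (\<alpha> * \<beta>) (bracket ?u y)) z =
        bracket ?v (bracket ?u z) \<ominus>\<^bsub>A\<^esub> bracket (P (\<beta> * \<alpha>) (bracket ?v x)) z"
      using x y z A.M.minus_eq_minus_swap[OF _ _ _ _ *] by (simp add: mult.commute[of \<beta> \<alpha>])
    \<comment> \<open>The mixed axioms need no splitting: the operator is applied to the whole
      commutator or anticommutator, so one Rota-Baxter step reduces each to a Leibniz rule.\<close>
    show "P (\<alpha> * \<beta>) (bracket ?u y \<ominus>\<^bsub>A\<^esub> bracket ?v x) \<otimes>\<^bsub>A\<^esub> z =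
        bracket ?u (?v \<otimes>\<^bsub>A\<^esub> z) \<ominus>\<^bsub>A\<^esub> ?v \<otimes>\<^bsub>A\<^esub> bracket ?u z"
      using x y z by (simp add: rb_bracket A.bracket_mult_right)
    show "bracket (P (\<alpha> * \<beta>) (?u \<otimes>\<^bsub>A\<^esub> y \<oplus>\<^bsub>A\<^esub> ?v \<otimes>\<^bsub>A\<^esub> x)) z =
        ?u \<otimes>\<^bsub>A\<^esub> bracket ?v z \<oplus>\<^bsub>A\<^esub> ?v \<otimes>\<^bsub>A\<^esub> bracket ?u z"
      using x y z by (simp add: rb_mult A.leibniz_left)
  qed
qed

end
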